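(* Let $A$ be a unital Banach algebra and let $a\in A$ be such that $a^{\dagger}$ exists. The following statements are equivalent: (i) $a$ is an EP Banach algebra element; (ii) $L_a\in L(A)$ is an EP operator; (iii) $a^{-1}(0)=(a^{\dagger})^{-1}(0)$; (iv) $aA=a^{\dagger}A$; (v) there exists an invertible operator $P\in L(A)$ such that $L_{a^{\dagger}}=PL_a=L_aP$; (vi) there exists an invertible operator $Q\in L(A)$ such that $L_a=QL_{a^{\dagger}}=L_{a^{\dagger}}Q$; (vii) $R_a\in L(A)$ is an EP operator; (viii) $a_{-1}(0)=(a^{\dagger})_{-1}(0)$; (ix) $Aa=Aa^{\dagger}$; (x) there exists an invertible operator $U\in L(A)$ such that $R_{a^{\dagger}}=UR_a=R_aU$; (xi) there exists an invertible operator $V\in L(A)$ such that $R_a=VR_{a^{\dagger}}=R_{a^{\dagger}}V$; (xii) $a^2a^{\dagger}=a=a^{\dagger}a^2$; (xiii) $a\in a^{\dagger}A\cap Aa^{\dagger}$; (xiv) $a^{\dagger}\in aA\cap Aa$; (xv) $a\in a^{\dagger}A^{-1}\cap A^{-1}a^{\dagger}$; (xvi) $a^{\dagger}\in aA^{-1}\cap A^{-1}a$; (xvii) $aA^{-1}=a^{\dagger}A^{-1}$; (xviii) $A^{-1}a=A^{-1}a^{\dagger}$.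
   Context: Scalars are complex. A unital Banach algebra $A$ has a unit $e$ with $\|e\|=1$; $A^{-1}$ is the set of invertible elements of $A$. $L(A)$ is the Banach algebra of bounded linear operators on the Banach space $A$ with the operator norm. For $c\in A$: $L_c,R_c\in L(A)$ are $L_c(x)=cx$, $R_c(x)=xc$; $c^{-1}(0)=\{x\in A: cx=0\}$, $c_{-1}(0)=\{x\in A: xc=0\}$, $cA=\{cx:x\in A\}$, $Ac=\{xc:x\in A\}$, $cA^{-1}=\{cx:x\in A^{-1}\}$, $A^{-1}c=\{xc:x\in A^{-1}\}$. An element $h$ of a unital Banach algebra is hermitian if $\|\exp(ith)\|=1$ for all $t\in\mathbb{R}$. The Moore-Penrose inverse of $a$, denoted $a^{\dagger}$, is the (at most one) $x$ in the algebra with $a=axa$, $x=xax$, and $ax$ and $xa$ hermitian. An element $a$ is EP if $a^{\dagger}$ exists and $aa^{\dagger}=a^{\dagger}a$. For operators on $A$ these notions are taken in the algebra $L(A)$. *)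

theory Defs
  imports "HOL-Analysis.Analysis"
begin

section \<open>Complex Banach algebras\<close>

class complex_normed_vector = real_normed_vector +
  fixes scaleC :: "complex \<Rightarrow> 'a \<Rightarrow> 'a" (infixr \<open>*\<^sub>C\<close> 75)
  assumes scaleC_add_right: "c *\<^sub>C (x + y) = c *\<^sub>C x + c *\<^sub>C y"
    and scaleC_add_left: "(c + d) *\<^sub>C x = c *\<^sub>C x + d *\<^sub>C x"
    and scaleC_scaleC: "c *\<^sub>C d *\<^sub>C x = (c * d) *\<^sub>C x"
    and scaleC_one: "1 *\<^sub>C x = x"
    and scaleR_eq_scaleC: "r *\<^sub>R x = complex_of_real r *\<^sub>C x"
    and norm_scaleC: "norm (c *\<^sub>C x) = cmod c * norm x"

class complex_banach_algebra_1 = complex_normed_vector + real_normed_algebra_1 + banach +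
  assumes mult_scaleC_left: "(c *\<^sub>C x) * y = c *\<^sub>C (x * y)"
    and mult_scaleC_right: "x * (c *\<^sub>C y) = c *\<^sub>C (x * y)"

lemma bounded_linear_scaleC: "bounded_linear (\<lambda>x::'a::complex_normed_vector. c *\<^sub>C x)"
proof (rule bounded_linear_intro[where K = "cmod c"])
  fix r and x :: 'a
  show "c *\<^sub>C r *\<^sub>R x = r *\<^sub>R c *\<^sub>C x"
    by (simp add: scaleR_eq_scaleC scaleC_scaleC mult.commute)
qed (simp_all add: scaleC_add_right norm_scaleC mult.commute)

lemma scaleC_simps:
  fixes x y :: "'a::complex_normed_vector"
  shows "c *\<^sub>C 0 = (0::'a)" "c *\<^sub>C (- x) = - (c *\<^sub>C x)" "c *\<^sub>C (x - y) = c *\<^sub>C x - c *\<^sub>C y"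
    "c *\<^sub>C r *\<^sub>R x = r *\<^sub>R c *\<^sub>C x"
  using bounded_linear.linear[OF bounded_linear_scaleC[of c, where 'a = 'a]]
  by (simp_all add: linear_0 linear_neg linear_diff linear_cmul)


section \<open>The Banach algebra of bounded operators\<close>

text \<open>
  Elements of \<^typ>\<open>'a \<Rightarrow>\<^sub>L 'a\<close> are only real-linear, so the bounded complex-linear operators form a
  subtype.
\<close>

typedef (overloaded) 'a bounded_op =
    "{f :: 'a::complex_normed_vector \<Rightarrow>\<^sub>L 'a. \<forall>c x. blinfun_apply f (c *\<^sub>C x) = c *\<^sub>C blinfun_apply f x}"
  morphisms blinfun_of_op op_of_blinfun
  by (rule exI[of _ 0]) (simp add: scaleC_simps)

setup_lifting type_definition_bounded_op

definition apply_op :: "'a::complex_normed_vector bounded_op \<Rightarrow> 'a \<Rightarrow> 'a" where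
  "apply_op f = blinfun_apply (blinfun_of_op f)"

lemma bounded_op_eqI: "(\<And>x. apply_op f x = apply_op g x) \<Longrightarrow> f = g"
  by (metis apply_op_def blinfun_eqI blinfun_of_op_inject)

instantiation bounded_op :: ("{complex_normed_vector, banach, perfect_space}")
  "{complex_normed_vector, real_normed_algebra_1}"
begin

lift_definition zero_bounded_op :: "'a bounded_op" is 0
  by (simp add: scaleC_simps)

lift_definition one_bounded_op :: "'a bounded_op" is id_blinfun
  by simp

lift_definition plus_bounded_op :: "'a bounded_op \<Rightarrow> 'a bounded_op \<Rightarrow> 'a bounded_op" is "(+)"
  by (simp add: blinfun.add_left scaleC_add_right)

lift_definition uminus_bounded_op :: "'a bounded_op \<Rightarrow> 'a bounded_op" is uminus
  by (simp add: blinfun.minus_left scaleC_simps)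

lift_definition minus_bounded_op :: "'a bounded_op \<Rightarrow> 'a bounded_op \<Rightarrow> 'a bounded_op" is "(-)"
  by (simp add: blinfun.diff_left scaleC_simps)

lift_definition times_bounded_op :: "'a bounded_op \<Rightarrow> 'a bounded_op \<Rightarrow> 'a bounded_op" is "(o\<^sub>L)"
  by simp

lift_definition scaleR_bounded_op :: "real \<Rightarrow> 'a bounded_op \<Rightarrow> 'a bounded_op" is "(*\<^sub>R)"
  by (simp add: blinfun.scaleR_left scaleC_simps)

lift_definition scaleC_bounded_op :: "complex \<Rightarrow> 'a bounded_op \<Rightarrow> 'a bounded_op"
  is "\<lambda>c f. blinfun_compose (Blinfun (\<lambda>x. c *\<^sub>C x)) f"
  by (simp add: bounded_linear_Blinfun_apply bounded_linear_scaleC scaleC_scaleC mult.commute)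

lift_definition norm_bounded_op :: "'a bounded_op \<Rightarrow> real" is norm .

definition sgn_bounded_op :: "'a bounded_op \<Rightarrow> 'a bounded_op" where
  "sgn_bounded_op f = scaleR (inverse (norm f)) f"

definition dist_bounded_op :: "'a bounded_op \<Rightarrow> 'a bounded_op \<Rightarrow> real" where
  "dist_bounded_op f g = norm (f - g)"

definition uniformity_bounded_op :: "('a bounded_op \<times> 'a bounded_op) filter" where
  "uniformity_bounded_op = (INF e\<in>{0 <..}. principal {(x, y). dist x y < e})"

definition open_bounded_op :: "'a bounded_op set \<Rightarrow> bool" where
  "open_bounded_op S = (\<forall>x\<in>S. \<forall>\<^sub>F (x', y) in uniformity. x' = x \<longrightarrow> y \<in> S)"

instance
proof
  fix f g h :: "'a bounded_op" and c d :: complex and r s :: real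
  note [simp] = bounded_linear_Blinfun_apply bounded_linear_scaleC
  show "dist f g = norm (f - g)" by (rule dist_bounded_op_def)
  show "sgn f = scaleR (inverse (norm f)) f" by (rule sgn_bounded_op_def)
  show "(uniformity :: ('a bounded_op \<times> 'a bounded_op) filter)
      = (INF e\<in>{0 <..}. principal {(x, y). dist x y < e})"
    by (rule uniformity_bounded_op_def)
  show "open S = (\<forall>x\<in>S. \<forall>\<^sub>F (x', y) in uniformity. x' = x \<longrightarrow> y \<in> S)" for S :: "'a bounded_op set"
    by (rule open_bounded_op_def)
  show "f + g + h = f + (g + h)" by transfer (rule add.assoc)
  show "f + g = g + f" by transfer (rule add.commute)
  show "0 + f = f" by transfer simp
  show "- f + f = 0" by transfer simp
  show "f - g = f + - g" by transfer simp
  show "r *\<^sub>R (f + g) = r *\<^sub>R f + r *\<^sub>R g" by transfer (rule scaleR_add_right)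
  show "(r + s) *\<^sub>R f = r *\<^sub>R f + s *\<^sub>R f" by transfer (rule scaleR_add_left)
  show "r *\<^sub>R s *\<^sub>R f = (r * s) *\<^sub>R f" by transfer simp
  show "1 *\<^sub>R f = f" by transfer simp
  show "(norm f = 0) = (f = 0)" by transfer simp
  have norm_ge: "0 \<le> norm f" for f :: "'a bounded_op" by transfer simp
  show "norm (f + g) \<le> norm f + norm g" by transfer (rule norm_triangle_ineq)
  show "norm (r *\<^sub>R f) = \<bar>r\<bar> * norm f" by transfer simp
  show "f * g * h = f * (g * h)" by transfer (simp add: blinfun_eqI)
  show "(f + g) * h = f * h + g * h" by transfer (simp add: blinfun_eqI blinfun.add_left)
  show "f * (g + h) = f * g + f * h"
    by transfer (simp add: blinfun_eqI blinfun.add_left blinfun.add_right)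
  show "r *\<^sub>R f * g = r *\<^sub>R (f * g)" by transfer (simp add: blinfun_eqI blinfun.scaleR_left)
  show "f * r *\<^sub>R g = r *\<^sub>R (f * g)"
    by transfer (simp add: blinfun_eqI blinfun.scaleR_left blinfun.scaleR_right)
  show "1 * f = f" by transfer (simp add: blinfun_eqI)
  show "f * 1 = f" by transfer (simp add: blinfun_eqI)
  show "norm (1 :: 'a bounded_op) = 1" by transfer simp
  then show "(0 :: 'a bounded_op) \<noteq> 1"
    by transfer (metis norm_zero zero_neq_one)
  show "norm (f * g) \<le> norm f * norm g" by transfer (rule norm_blinfun_compose)
  show "c *\<^sub>C (f + g) = c *\<^sub>C f + c *\<^sub>C g"
    by transfer (simp add: blinfun_eqI blinfun.add_left scaleC_add_right)
  show "(c + d) *\<^sub>C f = c *\<^sub>C f + d *\<^sub>C f"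
    by transfer (simp add: blinfun_eqI blinfun.add_left scaleC_add_left)
  show "c *\<^sub>C d *\<^sub>C f = (c * d) *\<^sub>C f"
    by transfer (simp add: blinfun_eqI scaleC_scaleC)
  show "1 *\<^sub>C f = f" by transfer (simp add: blinfun_eqI scaleC_one)
  show "r *\<^sub>R f = complex_of_real r *\<^sub>C f"
    by transfer (simp add: blinfun_eqI blinfun.scaleR_left scaleR_eq_scaleC)
  show "norm (c *\<^sub>C f) = cmod c * norm f"
  proof (rule antisym)
    have le: "norm (c *\<^sub>C f) \<le> cmod c * norm f" for c and f :: "'a bounded_op"
    proof transfer
      fix c and f :: "'a \<Rightarrow>\<^sub>L 'a"
      show "norm (Blinfun ((*\<^sub>C) c) o\<^sub>L f) \<le> cmod c * norm f"
        by (rule norm_blinfun_bound) (simp_all add: norm_scaleC mult.assoc mult_left_mono norm_blinfun)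
    qed
    then show "norm (c *\<^sub>C f) \<le> cmod c * norm f" .
    show "cmod c * norm f \<le> norm (c *\<^sub>C f)"
    proof (cases "c = 0")
      case False
      have "f = inverse c *\<^sub>C c *\<^sub>C f"
        using False by transfer (simp add: blinfun_eqI scaleC_scaleC scaleC_one)
      then have "norm f \<le> cmod (inverse c) * norm (c *\<^sub>C f)"
        using le by metis
      then have "cmod c * norm f \<le> cmod c * (cmod (inverse c) * norm (c *\<^sub>C f))"
        by (rule mult_left_mono) simp
      also have "\<dots> = norm (c *\<^sub>C f)"
        unfolding mult.assoc[symmetric] norm_mult[symmetric] using False by simp
      finally show ?thesis .
    qed (use norm_ge in simp)
  qed
qed

end

instance bounded_op :: ("{complex_normed_vector, banach, perfect_space}") complex_banach_algebra_1
proof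
  fix f g :: "'a bounded_op" and c :: complex
  note [simp] = bounded_linear_Blinfun_apply bounded_linear_scaleC
  show "c *\<^sub>C f * g = c *\<^sub>C (f * g)" by transfer (simp add: blinfun_eqI)
  show "f * c *\<^sub>C g = c *\<^sub>C (f * g)" by transfer (simp add: blinfun_eqI)
next
  fix X :: "nat \<Rightarrow> 'a bounded_op"
  assume "Cauchy X"
  then have "Cauchy (\<lambda>n. blinfun_of_op (X n))"
    unfolding Cauchy_def
    by (simp add: dist_bounded_op_def norm_bounded_op.rep_eq minus_bounded_op.rep_eq dist_norm)
  then obtain L where L: "(\<lambda>n. blinfun_of_op (X n)) \<longlonglongrightarrow> L"
    by (auto simp: Cauchy_convergent_iff convergent_def)
  have lim: "(\<lambda>n. blinfun_apply (blinfun_of_op (X n)) x) \<longlonglongrightarrow> blinfun_apply L x" for x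
    by (intro tendsto_intros L)
  have "blinfun_apply L (c *\<^sub>C x) = c *\<^sub>C blinfun_apply L x" for c x
  proof (rule LIMSEQ_unique[OF lim])
    have "blinfun_apply (blinfun_of_op f) (c *\<^sub>C x) = c *\<^sub>C blinfun_apply (blinfun_of_op f) x" for f
      using blinfun_of_op[of f] by simp
    then show "(\<lambda>n. blinfun_apply (blinfun_of_op (X n)) (c *\<^sub>C x)) \<longlonglongrightarrow> c *\<^sub>C blinfun_apply L x"
      using bounded_linear.tendsto[OF bounded_linear_scaleC lim] by simp
  qed
  then have "blinfun_of_op (op_of_blinfun L) = L"
    by (simp add: op_of_blinfun_inverse)
  with L have "X \<longlonglongrightarrow> op_of_blinfun L"
    by (simp add: lim_sequentially dist_bounded_op_def norm_bounded_op.rep_eq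
        minus_bounded_op.rep_eq dist_norm)
  then show "convergent X"
    by (rule convergentI)
qed

lemma apply_op_simps [simp]:
  fixes f g :: "'a::{complex_normed_vector, banach, perfect_space} bounded_op"
  shows "apply_op 0 x = (0::'a)" "apply_op 1 x = x" "apply_op (f + g) x = apply_op f x + apply_op g x"
    "apply_op (- f) x = - apply_op f x" "apply_op (f - g) x = apply_op f x - apply_op g x"
    "apply_op (f * g) x = apply_op f (apply_op g x)" "apply_op (c *\<^sub>C f) x = c *\<^sub>C apply_op f x"
    "apply_op (r *\<^sub>R f) x = r *\<^sub>R apply_op f x"
  by (simp_all add: apply_op_def zero_bounded_op.rep_eq one_bounded_op.rep_eq plus_bounded_op.rep_eq
      uminus_bounded_op.rep_eq minus_bounded_op.rep_eq times_bounded_op.rep_eq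
      scaleC_bounded_op.rep_eq scaleR_bounded_op.rep_eq blinfun.bilinear_simps
      bounded_linear_Blinfun_apply bounded_linear_scaleC)

lemma norm_bounded_op_eq_onorm:
  fixes f :: "'a::{complex_normed_vector, banach, perfect_space} bounded_op"
  shows "norm f = onorm (apply_op f)"
  by (simp add: apply_op_def norm_bounded_op.rep_eq norm_blinfun.rep_eq)

lift_definition left_mult :: "'a::complex_banach_algebra_1 \<Rightarrow> 'a bounded_op"
  is "\<lambda>c. Blinfun (\<lambda>x. c * x)"
  by (simp add: bounded_linear_Blinfun_apply bounded_linear_mult_right mult_scaleC_right)

lift_definition right_mult :: "'a::complex_banach_algebra_1 \<Rightarrow> 'a bounded_op"
  is "\<lambda>c. Blinfun (\<lambda>x. x * c)"
  by (simp add: bounded_linear_Blinfun_apply bounded_linear_mult_left mult_scaleC_left)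

lemma apply_op_left_mult [simp]: "apply_op (left_mult c) x = c * x"
  by (simp add: apply_op_def left_mult.rep_eq bounded_linear_Blinfun_apply bounded_linear_mult_right)

lemma apply_op_right_mult [simp]: "apply_op (right_mult c) x = x * c"
  by (simp add: apply_op_def right_mult.rep_eq bounded_linear_Blinfun_apply bounded_linear_mult_left)


section \<open>Moore--Penrose inverses and EP elements\<close>

definition hermitian :: "'a::complex_banach_algebra_1 \<Rightarrow> bool" where
  "hermitian h \<longleftrightarrow> (\<forall>t::real. norm (exp ((\<i> * complex_of_real t) *\<^sub>C h)) = 1)"

definition is_MP_inverse :: "'a::complex_banach_algebra_1 \<Rightarrow> 'a \<Rightarrow> bool" where
  "is_MP_inverse a x \<longleftrightarrow> a = a * x * a \<and> x = x * a * x \<and> hermitian (a * x) \<and> hermitian (x * a)"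

definition MP_invertible :: "'a::complex_banach_algebra_1 \<Rightarrow> bool" where
  "MP_invertible a \<longleftrightarrow> (\<exists>x. is_MP_inverse a x)"

lemma exp_scaleC_idempotent:
  fixes p :: "'a::complex_banach_algebra_1"
  assumes "p * p = p"
  shows "exp (c *\<^sub>C p) = 1 + (exp c - 1) *\<^sub>C p"
proof -
  have pow: "(c *\<^sub>C p) ^ Suc n = c ^ Suc n *\<^sub>C p" for n
    by (induction n)
      (simp_all add: mult_scaleC_left mult_scaleC_right scaleC_scaleC assms mult.commute)
  have lin: "bounded_linear (\<lambda>c. c *\<^sub>C p)"
    by (rule bounded_linear_intro[where K = "norm p"])
      (simp_all add: scaleC_add_left norm_scaleC scaleR_eq_scaleC scaleC_scaleC scaleR_conv_of_real)
  have "(\<lambda>n. c ^ Suc n /\<^sub>R fact (Suc n)) sums (exp c - 1)"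
    using exp_converges[of c] by (subst sums_Suc_iff) simp
  from bounded_linear.sums[OF lin this]
  have "(\<lambda>n. (c *\<^sub>C p) ^ Suc n /\<^sub>R fact (Suc n)) sums ((exp c - 1) *\<^sub>C p)"
    unfolding pow by (simp only: scaleR_eq_scaleC scaleC_scaleC scaleR_conv_of_real)
  then have "(\<lambda>n. (c *\<^sub>C p) ^ n /\<^sub>R fact n) sums ((exp c - 1) *\<^sub>C p + 1)"
    by (subst (asm) sums_Suc_iff) simp
  then show ?thesis
    using exp_converges[of "c *\<^sub>C p"] by (simp add: sums_unique2 add.commute)
qed

lemma hermitian_idempotent_norm:
  fixes p :: "'a::complex_banach_algebra_1"
  assumes "hermitian p" "p * p = p"
  shows "norm (1 - 2 * p) = 1"
proof -
  have "exp ((\<i> * complex_of_real pi) *\<^sub>C p) = 1 + (- 2) *\<^sub>C p"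
    by (simp add: exp_scaleC_idempotent[OF assms(2)])
  also have "\<dots> = 1 - 2 * p"
    using scaleC_add_left[of "- 1" "- 1" p] scaleR_eq_scaleC[of "- 1" p] by (simp add: mult_2)
  finally show ?thesis
    using assms(1) unfolding hermitian_def by metis
qed

lemma square_zero_eq_0:
  fixes d :: "'a::complex_banach_algebra_1"
  assumes "d * d = 0" "norm (1 + d) \<le> 1"
  shows "d = 0"
proof (rule ccontr)
  assume "d \<noteq> 0"
  have pow: "(1 + d) ^ n = 1 + real n *\<^sub>R d" for n
    by (induction n) (simp_all add: algebra_simps assms(1))
  have bound: "real n * norm d \<le> 2" for n
  proof -
    have "real n * norm d = norm ((1 + d) ^ n - 1)"
      by (simp add: pow)
    also have "\<dots> \<le> norm ((1 + d) ^ n) + 1"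
      using norm_triangle_ineq4[of "(1 + d) ^ n" 1] by simp
    also have "norm ((1 + d) ^ n) \<le> 1"
      using norm_power_ineq[of "1 + d" n] power_le_one[OF norm_ge_zero assms(2), of n] by linarith
    finally show ?thesis by simp
  qed
  obtain n where "2 / norm d < real n"
    using reals_Archimedean2 by blast
  with bound[of n] \<open>d \<noteq> 0\<close> show False
    by (simp add: divide_less_eq)
qed

lemma hermitian_idempotents_eq:
  fixes p q :: "'a::complex_banach_algebra_1"
  assumes "hermitian p" "hermitian q" "p * p = p" "q * q = q"
    and "p * q = q \<and> q * p = p \<or> p * q = p \<and> q * p = q"
  shows "p = q"
proof -
  have prod: "norm ((1 - 2 * p) * (1 - 2 * q)) \<le> 1"
    using norm_mult_ineq[of "1 - 2 * p" "1 - 2 * q"] assms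
    by (simp add: hermitian_idempotent_norm)
  have expand: "(1 - 2 * p) * (1 - 2 * q) = 1 - 2 * p - 2 * q + 2 * (2 * (p * q))"
    by (simp add: mult_2 ring_distribs)
  define d where "d = (if p * q = q then q - p else p - q)"
  have "(1 - 2 * p) * (1 - 2 * q) = 1 + (d + d)"
    unfolding expand d_def using assms(5) by (auto simp: mult_2)
  moreover have "d * d = 0"
    unfolding d_def using assms(3-5) by (auto simp: algebra_simps)
  then have "(d + d) * (d + d) = 0"
    by (simp add: ring_distribs)
  ultimately have "d + d = 0"
    using prod square_zero_eq_0 by metis
  then have "2 *\<^sub>R d = 0"
    by (simp add: scaleR_2)
  then show "p = q"
    by (simp add: d_def split: if_splits)
qed

lemma is_MP_inverse_unique:
  assumes "is_MP_inverse a x" "is_MP_inverse a y"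
  shows "x = y"
proof -
  have a: "a * x * a = a" "a * y * a = a" and xy: "x * a * x = x" "y * a * y = y"
    and herm: "hermitian (a * x)" "hermitian (a * y)" "hermitian (x * a)" "hermitian (y * a)"
    using assms unfolding is_MP_inverse_def by simp_all
  have "a * x = a * y"
    by (rule hermitian_idempotents_eq) (simp_all add: herm a flip: mult.assoc)
  moreover have "x * a = y * a"
  proof (rule hermitian_idempotents_eq)
    have "x * a * (y * a) = x * a" "y * a * (x * a) = y * a"
      using a by (metis mult.assoc)+
    then show "x * a * (y * a) = y * a \<and> y * a * (x * a) = x * a
        \<or> x * a * (y * a) = x * a \<and> y * a * (x * a) = y * a"
      by simp
  qed (simp_all add: herm xy flip: mult.assoc)
  ultimately show ?thesis
    using xy by (metis mult.assoc)
qed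

text \<open>The value of \<open>a\<^sup>\<dagger>\<close> is meaningful only if \<^term>\<open>MP_invertible a\<close>.\<close>

definition MP_inverse :: "'a::complex_banach_algebra_1 \<Rightarrow> 'a" (\<open>(_\<^sup>\<dagger>)\<close> [1000] 999) where
  "a\<^sup>\<dagger> = (THE x. is_MP_inverse a x)"

lemma MP_inverse_eq: "is_MP_inverse a x \<Longrightarrow> a\<^sup>\<dagger> = x"
  unfolding MP_inverse_def using is_MP_inverse_unique by blast

definition EP :: "'a::complex_banach_algebra_1 \<Rightarrow> bool" where
  "EP a \<longleftrightarrow> MP_invertible a \<and> a * a\<^sup>\<dagger> = a\<^sup>\<dagger> * a"

definition invertibles :: "'a::monoid_mult set" where
  "invertibles = {x. \<exists>y. x * y = 1 \<and> y * x = 1}"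

definition all_equivalent :: "bool list \<Rightarrow> bool" where
  "all_equivalent ps \<longleftrightarrow> (\<forall>p\<in>set ps. \<forall>q\<in>set ps. p \<longleftrightarrow> q)"

end

theory Submission
  imports Defs
begin

text \<open>
  Write \<open>b = a\<^sup>\<dagger>\<close>, \<open>p = ab\<close> and \<open>q = ba\<close>; these are hermitian idempotents, and \<open>a\<close> is EP iff \<open>p = q\<close>.
  Each one-sided condition amounts to a pair of product relations between \<open>p\<close> and \<open>q\<close>: equality of
  the right annihilators of \<open>a\<close> and \<open>b\<close>, or of \<open>Aa\<close> and \<open>Ab\<close>, gives \<open>pq = p\<close> and \<open>qp = q\<close>, and
  equality of the left annihilators, or of \<open>aA\<close> and \<open>bA\<close>, gives \<open>pq = q\<close> and \<open>qp = p\<close>; hermitian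
  idempotents related in this way coincide. Conversely, if \<open>p = q\<close>, then \<open>c = b\<^sup>2 + 1 - p\<close> is
  invertible with inverse \<open>a\<^sup>2 + 1 - p\<close> and \<open>ca = ac = b\<close>. The regular representations are isometric,
  so they carry Moore--Penrose inverses to Moore--Penrose inverses.
\<close>

section \<open>Regular representations\<close>

text \<open>Apply \<open>f\<close> termwise to the exponential series. Asking only that powers of
  \<open>x\<close> be respected lets the result also cover \<open>right_mult\<close>, which reverses
  products.\<close>

lemma exp_bounded_linear_image:
  fixes f :: "'a::{real_normed_algebra_1,banach} \<Rightarrow> 'b::{real_normed_algebra_1,banach}"
  assumes "bounded_linear f" "\<And>n. f (x ^ n) = f x ^ n"
  shows "f (exp x) = exp (f x)"
proof -
  have "(\<lambda>n. f x ^ n /\<^sub>R fact n) sums f (exp x)"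
    using bounded_linear.sums[OF assms(1) exp_converges[of x]] assms
    by (simp add: linear_simps(5))
  then show ?thesis
    using exp_converges sums_unique2 by blast
qed

lemma hermitian_image:
  fixes f :: "'a::complex_banach_algebra_1 \<Rightarrow> 'b::complex_banach_algebra_1"
  assumes "bounded_linear f" "\<And>x. norm (f x) = norm x" "\<And>c x. f (c *\<^sub>C x) = c *\<^sub>C f x"
    and "\<And>x n. f (x ^ n) = f x ^ n"
  shows "hermitian (f h) \<longleftrightarrow> hermitian h"
  unfolding hermitian_def
  by (simp add: assms(2) flip: assms(3) exp_bounded_linear_image[OF assms(1,4)])

text \<open>The upper bound is submultiplicativity; evaluation at the unit, which has norm 1,
  attains it.\<close>

lemma norm_left_mult [simp]: "norm (left_mult c) = norm c"
proof -
  have "onorm ((*) c) = norm c"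
  proof (rule antisym)
    show "onorm ((*) c) \<le> norm c"
      by (rule onorm_bound) (simp_all add: norm_mult_ineq)
    show "norm c \<le> onorm ((*) c)"
      using onorm[OF bounded_linear_mult_right[of c], of 1] by simp
  qed
  moreover have "apply_op (left_mult c) = (*) c"
    by (simp add: fun_eq_iff)
  ultimately show ?thesis
    by (simp add: norm_bounded_op_eq_onorm)
qed

lemma norm_right_mult [simp]: "norm (right_mult c) = norm c"
proof -
  have "onorm (\<lambda>x. x * c) = norm c"
  proof (rule antisym)
    show "onorm (\<lambda>x. x * c) \<le> norm c"
      by (rule onorm_bound) (simp_all add: mult.commute[of "norm c"] norm_mult_ineq)
    show "norm c \<le> onorm (\<lambda>x. x * c)"
      using onorm[OF bounded_linear_mult_left[of c], of 1] by simp
  qed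
  moreover have "apply_op (right_mult c) = (\<lambda>x. x * c)"
    by (simp add: fun_eq_iff)
  ultimately show ?thesis
    by (simp add: norm_bounded_op_eq_onorm)
qed

lemma left_mult_mult: "left_mult (c * d) = left_mult c * left_mult d"
  by (rule bounded_op_eqI) (simp add: mult.assoc)

lemma right_mult_mult: "right_mult (c * d) = right_mult d * right_mult c"
  by (rule bounded_op_eqI) (simp add: mult.assoc)

lemma left_mult_one: "left_mult 1 = 1"
  by (rule bounded_op_eqI) simp

lemma right_mult_one: "right_mult 1 = 1"
  by (rule bounded_op_eqI) simp

lemma inj_left_mult: "inj left_mult"
  by (rule injI) (metis apply_op_left_mult mult.right_neutral)

lemma inj_right_mult: "inj right_mult"
  by (rule injI) (metis apply_op_right_mult mult.left_neutral)

lemma bounded_linear_left_mult: "bounded_linear left_mult"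
  by (rule bounded_linear_intro[where K = 1])
    (auto intro!: bounded_op_eqI simp: ring_distribs)

lemma bounded_linear_right_mult: "bounded_linear right_mult"
  by (rule bounded_linear_intro[where K = 1])
    (auto intro!: bounded_op_eqI simp: ring_distribs)

lemma hermitian_left_mult: "hermitian (left_mult h) \<longleftrightarrow> hermitian h"
proof (rule hermitian_image[OF bounded_linear_left_mult])
  show "left_mult (x ^ n) = left_mult x ^ n" for x :: 'a and n
    by (induction n) (simp_all add: left_mult_one left_mult_mult)
qed (auto intro: bounded_op_eqI simp: mult_scaleC_left)

lemma hermitian_right_mult: "hermitian (right_mult h) \<longleftrightarrow> hermitian h"
proof (rule hermitian_image[OF bounded_linear_right_mult])
  \<comment> \<open>Reversing the order of factors is harmless here, since powers of one element
    commute.\<close>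
  show "right_mult (x ^ n) = right_mult x ^ n" for x :: 'a and n
    by (induction n) (simp_all add: right_mult_one right_mult_mult power_commutes)
qed (auto intro: bounded_op_eqI simp: mult_scaleC_right)

lemma is_MP_inverse_left_mult: "is_MP_inverse a b \<Longrightarrow> is_MP_inverse (left_mult a) (left_mult b)"
  by (simp add: is_MP_inverse_def hermitian_left_mult flip: left_mult_mult)

text \<open>Because \<open>right_mult\<close> reverses products, the two hermitian conditions trade
  places.\<close>

lemma is_MP_inverse_right_mult: "is_MP_inverse a b \<Longrightarrow> is_MP_inverse (right_mult a) (right_mult b)"
  by (simp add: is_MP_inverse_def hermitian_right_mult mult.assoc flip: right_mult_mult)

lemma invertibles_left_mult: "c \<in> invertibles \<Longrightarrow> left_mult c \<in> invertibles"
  unfolding invertibles_def mem_Collect_eq by (metis left_mult_mult left_mult_one)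

lemma invertibles_right_mult: "c \<in> invertibles \<Longrightarrow> right_mult c \<in> invertibles"
  unfolding invertibles_def mem_Collect_eq by (metis right_mult_mult right_mult_one)

section \<open>Kernels and invertible factors\<close>

lemma apply_op_invertible_eq_0_iff:
  fixes P :: "'a::{complex_normed_vector, banach, perfect_space} bounded_op"
  assumes "P \<in> invertibles"
  shows "apply_op P y = 0 \<longleftrightarrow> y = 0"
proof -
  obtain R where "R * P = 1"
    using assms unfolding invertibles_def by auto
  then have "apply_op R (apply_op P y) = y"
    by (metis apply_op_simps(2,6))
  moreover have "apply_op f 0 = 0" for f :: "'a bounded_op"
    by (simp add: apply_op_def blinfun.zero_right)
  ultimately show ?thesis
    by metis
qed

text \<open>The right annihilator of an element is the kernel of its left multiplication, and
  composing with the injective \<open>P\<close> on the outside preserves kernels.\<close>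

lemma kernel_left_mult_factor:
  assumes "P \<in> invertibles" "left_mult b = P * left_mult a"
  shows "{x. a * x = 0} = {x. b * x = 0}"
  using apply_op_invertible_eq_0_iff[OF assms(1)] assms(2)
  by (metis apply_op_left_mult apply_op_simps(6))

lemma kernel_right_mult_factor:
  assumes "P \<in> invertibles" "right_mult b = P * right_mult a"
  shows "{x. x * a = 0} = {x. x * b = 0}"
  using apply_op_invertible_eq_0_iff[OF assms(1)] assms(2)
  by (metis apply_op_right_mult apply_op_simps(6))

lemma invertibles_mult: "c \<in> invertibles \<Longrightarrow> d \<in> invertibles \<Longrightarrow> c * d \<in> invertibles"
proof -
  assume "c \<in> invertibles" "d \<in> invertibles"
  then obtain c' d' where "c * c' = 1" "c' * c = 1" "d * d' = 1" "d' * d = 1"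
    unfolding invertibles_def by auto
  then have "c * d * (d' * c') = 1 \<and> d' * c' * (c * d) = 1"
    by (metis mult.assoc mult.right_neutral)
  then show "c * d \<in> invertibles"
    unfolding invertibles_def by blast
qed

lemma one_in_invertibles: "1 \<in> invertibles"
  unfolding invertibles_def by auto

section \<open>Commuting with the Moore--Penrose inverse\<close>

lemma EP_iff: "is_MP_inverse a b \<Longrightarrow> EP a \<longleftrightarrow> a * b = b * a"
  unfolding EP_def MP_invertible_def using MP_inverse_eq by blast

text \<open>The product \<open>a * b\<close> is an idempotent whose left multiplication projects
  onto the right ideal of \<open>a\<close>, so membership there means being fixed. This turns ideal
  conditions into equations.\<close>

lemma in_range_mult_left_iff:
  fixes a b :: "'a::semigroup_mult"
  assumes "a * (b * a) = a"
  shows "y \<in> range (\<lambda>x. a * x) \<longleftrightarrow> a * (b * y) = y"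
proof
  assume "y \<in> range (\<lambda>x. a * x)"
  then obtain x where "y = a * x"
    by blast
  then have "a * (b * y) = a * (b * a) * x"
    by (simp add: mult.assoc)
  then show "a * (b * y) = y"
    using assms \<open>y = a * x\<close> by simp
qed (rule range_eqI[OF sym])

lemma in_range_mult_right_iff:
  fixes a b :: "'a::semigroup_mult"
  assumes "a * (b * a) = a"
  shows "y \<in> range (\<lambda>x. x * a) \<longleftrightarrow> y * (b * a) = y"
proof
  assume "y \<in> range (\<lambda>x. x * a)"
  then show "y * (b * a) = y"
    using assms by (auto simp: mult.assoc)
next
  assume "y * (b * a) = y"
  then have "y = y * b * a"
    by (simp add: mult.assoc)
  then show "y \<in> range (\<lambda>x. x * a)"
    by (rule range_eqI)
qed

section \<open>Relations that force \<open>a\<close> and \<open>b\<close> to commute\<close>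

context
  fixes a b :: "'a::complex_banach_algebra_1"
  assumes MP: "is_MP_inverse a b"
begin

lemma MP_inverse_simps: "a * (b * a) = a" "b * (a * b) = b"
  using MP unfolding is_MP_inverse_def by (simp_all add: mult.assoc)

text \<open>The hermitian conditions enter here: the first alternative says that the idempotents
  \<open>a * b\<close> and \<open>b * a\<close> have the same range under left multiplication, the
  second that they have the same kernel, and \<open>hermitian_idempotents_eq\<close> handles
  both.\<close>

lemma commute_if_products:
  assumes "a * b * (b * a) = b * a \<and> b * a * (a * b) = a * b
    \<or> a * b * (b * a) = a * b \<and> b * a * (a * b) = b * a"
  shows "a * b = b * a"
proof (rule hermitian_idempotents_eq)
  show "hermitian (a * b)" "hermitian (b * a)"
    using MP unfolding is_MP_inverse_def by simp_all
  show "a * b * (a * b) = a * b" "b * a * (b * a) = b * a"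
    by (simp_all add: mult.assoc MP_inverse_simps)
qed (use assms in blast)

text \<open>The hypotheses express that \<open>a\<close> and \<open>b\<close> lie in each other's
  right ideals; multiplying them on the right by \<open>a\<close> and by \<open>b\<close> gives the
  equal-range alternative.\<close>

lemma commute_if_products_left:
  assumes "a * b * b = b" "b * a * a = a"
  shows "a * b = b * a"
proof (rule commute_if_products)
  have "a * b * (b * a) = a * b * b * a" "b * a * (a * b) = b * a * a * b"
    by (simp_all add: mult.assoc)
  then show "a * b * (b * a) = b * a \<and> b * a * (a * b) = a * b
    \<or> a * b * (b * a) = a * b \<and> b * a * (a * b) = b * a"
    using assms by simp
qed

lemma commute_if_products_right:
  assumes "b * b * a = b" "a * a * b = a"
  shows "a * b = b * a"
proof (rule commute_if_products)
  have "a * b * (b * a) = a * (b * b * a)" "b * a * (a * b) = b * (a * a * b)"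
    by (simp_all add: mult.assoc)
  then show "a * b * (b * a) = b * a \<and> b * a * (a * b) = a * b
    \<or> a * b * (b * a) = a * b \<and> b * a * (a * b) = b * a"
    using assms by simp
qed

text \<open>Evaluate \<open>b * a * a * b\<close> in two ways: it is \<open>a * b\<close> by the
  second hypothesis and \<open>b * a\<close> by the first.\<close>

lemma commute_if_products_absorb:
  assumes "a * a * b = a" "b * a * a = a"
  shows "a * b = b * a"
  by (metis assms mult.assoc)

text \<open>The same argument with \<open>a * b * b * a\<close>.\<close>

lemma commute_if_products_absorb':
  assumes "a * b * b = b" "b * b * a = b"
  shows "a * b = b * a"
  by (metis assms mult.assoc)

lemma MP_inverse_in_range_left_iff:
  "b \<in> range (\<lambda>x. a * x) \<longleftrightarrow> a * b * b = b"
  "a \<in> range (\<lambda>x. b * x) \<longleftrightarrow> b * a * a = a"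
  using MP_inverse_simps by (simp_all add: in_range_mult_left_iff mult.assoc)

lemma MP_inverse_in_range_right_iff:
  "b \<in> range (\<lambda>x. x * a) \<longleftrightarrow> b * b * a = b"
  "a \<in> range (\<lambda>x. x * b) \<longleftrightarrow> a * a * b = a"
  using MP_inverse_simps by (simp_all add: in_range_mult_right_iff mult.assoc)

lemma commute_products:
  assumes "a * b = b * a"
  shows "a * a * b = a" "b * a * a = a" "a * b * b = b" "b * b * a = b"
  using MP_inverse_simps assms by (metis mult.assoc)+

lemma commute_invertible:
  assumes "a * b = b * a"
  obtains c d where "c \<in> invertibles" "d \<in> invertibles" "c * a = b" "a * c = b" "d * b = a" "b * d = a"
proof -
  \<comment> \<open>Put \<open>p = a * b = b * a\<close>. In the corner algebra with unit
    \<open>p\<close>, the elements \<open>a\<close> and \<open>b\<close> are mutually inverse, and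
    both are annihilated by \<open>1 - p\<close>. So \<open>c\<close> is \<open>b * b\<close> on the
    corner plus the identity on the complement, and \<open>d\<close> likewise with
    \<open>a * a\<close>.\<close>
  define c where "c = b * b + 1 - a * b"
  define d where "d = a * a + 1 - a * b"
  note s = commute_products[OF assms, unfolded mult.assoc] MP_inverse_simps
  have cd: "c * a = b" "a * c = b" "d * b = a" "b * d = a"
    unfolding c_def d_def using s assms
    by (simp_all add: ring_distribs mult.assoc)
  \<comment> \<open>Only one factor is expanded, so that \<open>cd\<close> reduces the right-hand
    side to \<open>b * a + c - b * b\<close>, which is 1 by the definition of
    \<open>c\<close>.\<close>
  have "c * d = c * a * a + c - c * a * b"
    by (simp add: d_def distrib_left right_diff_distrib mult.assoc)
  moreover have "d * c = d * b * b + d - d * b * a"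
    by (simp add: c_def assms distrib_left right_diff_distrib mult.assoc)
  ultimately have "c * d = 1" "d * c = 1"
    unfolding cd using assms by (simp_all add: c_def d_def)
  then have "c \<in> invertibles" "d \<in> invertibles"
    unfolding invertibles_def by auto
  with cd show thesis
    using that by blast
qed

section \<open>Annihilators and principal ideals\<close>

lemma commute_iff_right_annihilators: "{x. a * x = 0} = {x. b * x = 0} \<longleftrightarrow> a * b = b * a"
proof
  assume eq: "{x. a * x = 0} = {x. b * x = 0}"
  \<comment> \<open>These elements generate the two annihilators as right ideals. Exchanging the
    annihilators yields exactly the hypotheses of \<open>commute_if_products_right\<close>.\<close>
  have "a * (1 - b * a) = 0" "b * (1 - a * b) = 0"
    using MP_inverse_simps by (simp_all add: right_diff_distrib)
  then have "b * (1 - b * a) = 0" "a * (1 - a * b) = 0"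
    using eq by blast+
  then show "a * b = b * a"
    by (intro commute_if_products_right) (simp_all add: right_diff_distrib mult.assoc)
next
  assume comm: "a * b = b * a"
  have "a * x = a * a * (b * x)" "b * x = b * b * (a * x)" for x
    by (simp_all add: commute_products[OF comm] flip: mult.assoc)
  then have "a * x = 0 \<longleftrightarrow> b * x = 0" for x
    by (metis mult_zero_right)
  then show "{x. a * x = 0} = {x. b * x = 0}"
    by blast
qed

lemma commute_iff_left_annihilators: "{x. x * a = 0} = {x. x * b = 0} \<longleftrightarrow> a * b = b * a"
proof
  assume eq: "{x. x * a = 0} = {x. x * b = 0}"
  have "(1 - a * b) * a = 0" "(1 - b * a) * b = 0"
    using MP_inverse_simps by (simp_all add: left_diff_distrib mult.assoc)
  then have "(1 - a * b) * b = 0" "(1 - b * a) * a = 0"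
    using eq by blast+
  then show "a * b = b * a"
    by (intro commute_if_products_left) (simp_all add: left_diff_distrib)
next
  assume comm: "a * b = b * a"
  have "x * a = x * b * (a * a)" "x * b = x * a * (b * b)" for x
    by (simp_all add: mult.assoc commute_products[OF comm, unfolded mult.assoc])
  then have "x * a = 0 \<longleftrightarrow> x * b = 0" for x
    by (metis mult_zero_left)
  then show "{x. x * a = 0} = {x. x * b = 0}"
    by blast
qed

lemma commute_iff_right_ideals: "range (\<lambda>x. a * x) = range (\<lambda>x. b * x) \<longleftrightarrow> a * b = b * a"
proof
  assume eq: "range (\<lambda>x. a * x) = range (\<lambda>x. b * x)"
  have "a \<in> range (\<lambda>x. a * x)" "b \<in> range (\<lambda>x. b * x)"
    by (auto intro: range_eqI[of _ _ 1])
  then show "a * b = b * a"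
    using eq MP_inverse_in_range_left_iff commute_if_products_left by blast
next
  assume comm: "a * b = b * a"
  have eq: "a * x = b * (a * a * x)" "b * x = a * (b * b * x)" for x
    by (simp_all add: commute_products[OF comm] flip: mult.assoc)
  show "range (\<lambda>x. a * x) = range (\<lambda>x. b * x)"
    by (intro equalityI image_subsetI; rule range_eqI, rule eq)
qed

lemma commute_iff_left_ideals: "range (\<lambda>x. x * a) = range (\<lambda>x. x * b) \<longleftrightarrow> a * b = b * a"
proof
  assume eq: "range (\<lambda>x. x * a) = range (\<lambda>x. x * b)"
  have "a \<in> range (\<lambda>x. x * a)" "b \<in> range (\<lambda>x. x * b)"
    by (auto intro: range_eqI[of _ _ 1])
  then show "a * b = b * a"
    using eq MP_inverse_in_range_right_iff commute_if_products_right by blast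
next
  assume comm: "a * b = b * a"
  have eq: "x * a = x * a * a * b" "x * b = x * b * b * a" for x
    by (simp_all add: mult.assoc commute_products[OF comm, unfolded mult.assoc])
  show "range (\<lambda>x. x * a) = range (\<lambda>x. x * b)"
    by (intro equalityI image_subsetI; rule range_eqI, rule eq)
qed

section \<open>Factorizations by invertible operators\<close>

lemma commute_iff_MP_inverse_left_factor:
  "(\<exists>P\<in>invertibles. left_mult b = P * left_mult a \<and> P * left_mult a = left_mult a * P)
    \<longleftrightarrow> a * b = b * a" (is "?L \<longleftrightarrow> _")
proof
  assume ?L
  then show "a * b = b * a"
    using kernel_left_mult_factor commute_iff_right_annihilators by metis
next
  assume "a * b = b * a"
  then show ?L
    \<comment> \<open>The operator is \<open>left_mult c\<close>, with
      \<open>c * a = b = a * c\<close>.\<close>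
    by (elim commute_invertible) (metis invertibles_left_mult left_mult_mult)
qed

lemma commute_iff_left_factor:
  "(\<exists>Q\<in>invertibles. left_mult a = Q * left_mult b \<and> Q * left_mult b = left_mult b * Q)
    \<longleftrightarrow> a * b = b * a" (is "?L \<longleftrightarrow> _")
proof
  assume ?L
  then show "a * b = b * a"
    using kernel_left_mult_factor commute_iff_right_annihilators by metis
next
  assume "a * b = b * a"
  then show ?L
    by (elim commute_invertible) (metis invertibles_left_mult left_mult_mult)
qed

lemma commute_iff_MP_inverse_right_factor:
  "(\<exists>U\<in>invertibles. right_mult b = U * right_mult a \<and> U * right_mult a = right_mult a * U)
    \<longleftrightarrow> a * b = b * a" (is "?L \<longleftrightarrow> _")
proof
  assume ?L
  then show "a * b = b * a"
    using kernel_right_mult_factor commute_iff_left_annihilators by metis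
next
  assume "a * b = b * a"
  then show ?L
    \<comment> \<open>Here \<open>right_mult c\<close> serves: its two products with
      \<open>right_mult a\<close> come from \<open>a * c\<close> and \<open>c * a\<close>.\<close>
    by (elim commute_invertible) (metis invertibles_right_mult right_mult_mult)
qed

lemma commute_iff_right_factor:
  "(\<exists>V\<in>invertibles. right_mult a = V * right_mult b \<and> V * right_mult b = right_mult b * V)
    \<longleftrightarrow> a * b = b * a" (is "?L \<longleftrightarrow> _")
proof
  assume ?L
  then show "a * b = b * a"
    using kernel_right_mult_factor commute_iff_left_annihilators by metis
next
  assume "a * b = b * a"
  then show ?L
    by (elim commute_invertible) (metis invertibles_right_mult right_mult_mult)
qed

section \<open>Absorption, membership and orbits of the invertible group\<close>

lemma commute_iff_square: "a\<^sup>2 * b = a \<and> a = b * a\<^sup>2 \<longleftrightarrow> a * b = b * a"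
proof -
  have "a\<^sup>2 * b = a * a * b" "b * a\<^sup>2 = b * a * a"
    by (simp_all add: power2_eq_square mult.assoc)
  then show ?thesis
    using commute_if_products_absorb commute_products(1,2) by metis
qed

lemma commute_iff_in_ideals:
  "a \<in> range (\<lambda>x. b * x) \<inter> range (\<lambda>x. x * b) \<longleftrightarrow> a * b = b * a"
  unfolding Int_iff MP_inverse_in_range_left_iff MP_inverse_in_range_right_iff
  using commute_if_products_absorb commute_products by blast

lemma commute_iff_MP_inverse_in_ideals:
  "b \<in> range (\<lambda>x. a * x) \<inter> range (\<lambda>x. x * a) \<longleftrightarrow> a * b = b * a"
  unfolding Int_iff MP_inverse_in_range_left_iff MP_inverse_in_range_right_iff
  using commute_if_products_absorb' commute_products by blast

lemma commute_iff_associated: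
  "a \<in> (\<lambda>x. b * x) ` invertibles \<inter> (\<lambda>x. x * b) ` invertibles \<longleftrightarrow> a * b = b * a" (is "?L \<longleftrightarrow> _")
proof
  assume ?L
  then show "a * b = b * a"
    using commute_iff_in_ideals by blast
next
  assume "a * b = b * a"
  then obtain c d where cd: "c \<in> invertibles" "d \<in> invertibles"
    "c * a = b" "a * c = b" "d * b = a" "b * d = a"
    by (rule commute_invertible)
  then show ?L
    using image_eqI[where f = "\<lambda>x. b * x", OF cd(6)[symmetric] cd(2)]
      image_eqI[where f = "\<lambda>x. x * b", OF cd(5)[symmetric] cd(2)] by blast
qed

lemma commute_iff_MP_inverse_associated:
  "b \<in> (\<lambda>x. a * x) ` invertibles \<inter> (\<lambda>x. x * a) ` invertibles \<longleftrightarrow> a * b = b * a" (is "?L \<longleftrightarrow> _")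
proof
  assume ?L
  then show "a * b = b * a"
    using commute_iff_MP_inverse_in_ideals by blast
next
  assume "a * b = b * a"
  then obtain c d where cd: "c \<in> invertibles" "d \<in> invertibles"
    "c * a = b" "a * c = b" "d * b = a" "b * d = a"
    by (rule commute_invertible)
  then show ?L
    using image_eqI[where f = "\<lambda>x. a * x", OF cd(4)[symmetric] cd(1)]
      image_eqI[where f = "\<lambda>x. x * a", OF cd(3)[symmetric] cd(1)] by blast
qed

lemma commute_iff_right_orbits:
  "(\<lambda>x. a * x) ` invertibles = (\<lambda>x. b * x) ` invertibles \<longleftrightarrow> a * b = b * a" (is "?L \<longleftrightarrow> _")
proof
  assume eq: ?L
  have "a \<in> (\<lambda>x. a * x) ` invertibles" "b \<in> (\<lambda>x. b * x) ` invertibles"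
    using one_in_invertibles by (auto intro: image_eqI[of _ _ 1])
  \<comment> \<open>Equality of the orbits is weakened to mutual membership in principal right
    ideals.\<close>
  then have "b \<in> range (\<lambda>x. a * x)" "a \<in> range (\<lambda>x. b * x)"
    using eq by blast+
  then show "a * b = b * a"
    using MP_inverse_in_range_left_iff commute_if_products_left by blast
next
  assume "a * b = b * a"
  then obtain c d where cd: "c \<in> invertibles" "d \<in> invertibles" "a * c = b" "b * d = a"
    by (rule commute_invertible)
  then have eq: "a * x = b * (d * x)" "b * x = a * (c * x)" for x
    by (simp_all flip: mult.assoc)
  show ?L
    by (intro equalityI image_subsetI; rule image_eqI, rule eq)
      (simp_all add: invertibles_mult cd)
qed

lemma commute_iff_left_orbits:
  "(\<lambda>x. x * a) ` invertibles = (\<lambda>x. x * b) ` invertibles \<longleftrightarrow> a * b = b * a" (is "?L \<longleftrightarrow> _")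
proof
  assume eq: ?L
  have "a \<in> (\<lambda>x. x * a) ` invertibles" "b \<in> (\<lambda>x. x * b) ` invertibles"
    using one_in_invertibles by (auto intro: image_eqI[of _ _ 1])
  then have "b \<in> range (\<lambda>x. x * a)" "a \<in> range (\<lambda>x. x * b)"
    using eq by blast+
  then show "a * b = b * a"
    using MP_inverse_in_range_right_iff commute_if_products_right by blast
next
  assume "a * b = b * a"
  then obtain c d where cd: "c \<in> invertibles" "d \<in> invertibles" "c * a = b" "d * b = a"
    by (rule commute_invertible)
  then have eq: "x * a = x * d * b" "x * b = x * c * a" for x
    by (simp_all add: mult.assoc)
  show ?L
    by (intro equalityI image_subsetI; rule image_eqI, rule eq)
      (simp_all add: invertibles_mult cd)
qed

text \<open>As \<open>left_mult b\<close> is the Moore-Penrose inverse of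
  \<open>left_mult a\<close>, being EP is a commutation of operators, which injectivity of
  \<open>left_mult\<close> pulls back to the algebra.\<close>

lemma EP_left_mult_iff: "EP (left_mult a) \<longleftrightarrow> a * b = b * a"
  using EP_iff[OF is_MP_inverse_left_mult[OF MP]]
  by (simp add: inj_eq[OF inj_left_mult] flip: left_mult_mult)

lemma EP_right_mult_iff: "EP (right_mult a) \<longleftrightarrow> a * b = b * a"
  using EP_iff[OF is_MP_inverse_right_mult[OF MP]]
  by (simp add: inj_eq[OF inj_right_mult] eq_commute flip: right_mult_mult)

end

theorem theorem18:
  fixes a :: "'a::complex_banach_algebra_1"
  assumes "MP_invertible a"
  shows "all_equivalent
   [EP a,
    EP (left_mult a),
    {x. a * x = 0} = {x. a\<^sup>\<dagger> * x = 0},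
    range (\<lambda>x. a * x) = range (\<lambda>x. a\<^sup>\<dagger> * x),
    \<exists>P\<in>invertibles. left_mult (a\<^sup>\<dagger>) = P * left_mult a \<and> P * left_mult a = left_mult a * P,
    \<exists>Q\<in>invertibles. left_mult a = Q * left_mult (a\<^sup>\<dagger>) \<and> Q * left_mult (a\<^sup>\<dagger>) = left_mult (a\<^sup>\<dagger>) * Q,
    EP (right_mult a),
    {x. x * a = 0} = {x. x * a\<^sup>\<dagger> = 0},
    range (\<lambda>x. x * a) = range (\<lambda>x. x * a\<^sup>\<dagger>),
    \<exists>U\<in>invertibles. right_mult (a\<^sup>\<dagger>) = U * right_mult a \<and> U * right_mult a = right_mult a * U,
    \<exists>V\<in>invertibles. right_mult a = V * right_mult (a\<^sup>\<dagger>) \<and> V * right_mult (a\<^sup>\<dagger>) = right_mult (a\<^sup>\<dagger>) * V,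
    a\<^sup>2 * a\<^sup>\<dagger> = a \<and> a = a\<^sup>\<dagger> * a\<^sup>2,
    a \<in> range (\<lambda>x. a\<^sup>\<dagger> * x) \<inter> range (\<lambda>x. x * a\<^sup>\<dagger>),
    a\<^sup>\<dagger> \<in> range (\<lambda>x. a * x) \<inter> range (\<lambda>x. x * a),
    a \<in> (\<lambda>x. a\<^sup>\<dagger> * x) ` invertibles \<inter> (\<lambda>x. x * a\<^sup>\<dagger>) ` invertibles,
    a\<^sup>\<dagger> \<in> (\<lambda>x. a * x) ` invertibles \<inter> (\<lambda>x. x * a) ` invertibles,
    (\<lambda>x. a * x) ` invertibles = (\<lambda>x. a\<^sup>\<dagger> * x) ` invertibles,
    (\<lambda>x. x * a) ` invertibles = (\<lambda>x. x * a\<^sup>\<dagger>) ` invertibles]"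
proof -
  obtain b where MP: "is_MP_inverse a b"
    using assms unfolding MP_invertible_def by blast
  show ?thesis
    \<comment> \<open>Each listed condition is rewritten to the single equation
      \<open>a * b = b * a\<close>.\<close>
    unfolding MP_inverse_eq[OF MP] EP_iff[OF MP] EP_left_mult_iff[OF MP] EP_right_mult_iff[OF MP]
      commute_iff_right_annihilators[OF MP] commute_iff_left_annihilators[OF MP]
      commute_iff_right_ideals[OF MP] commute_iff_left_ideals[OF MP]
      commute_iff_MP_inverse_left_factor[OF MP] commute_iff_left_factor[OF MP]
      commute_iff_MP_inverse_right_factor[OF MP] commute_iff_right_factor[OF MP]
      commute_iff_square[OF MP] commute_iff_in_ideals[OF MP] commute_iff_MP_inverse_in_ideals[OF MP]
      commute_iff_associated[OF MP] commute_iff_MP_inverse_associated[OF MP]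
      commute_iff_right_orbits[OF MP] commute_iff_left_orbits[OF MP]
    by (simp add: all_equivalent_def)
qed

end
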